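(* Let $G$ be a bipartite graph, let $n$ be a positive integer, and let $\mathcal{F}=\{F_1,\ldots,F_n\}$ be a family of $n$ matchings in $G$, each of size $\lfloor \frac{5}{3}n\rfloor$. Then $\mathcal{F}$ has a full rainbow matching.
   Context: A matching is a set of pairwise disjoint edges (no two share a vertex), and its size is its number of edges. The matchings in the family $\mathcal{F}=\{F_1,\ldots,F_n\}$ are indexed by $1,\ldots,n$; they are not assumed to be pairwise edge-disjoint or pairwise distinct. A (partial) rainbow matching of $\mathcal{F}$ is a choice of pairwise disjoint edges from some of the $F_i$'s, one edge from each chosen $F_i$; that is, a set of indices $I\subseteq\{1,\ldots,n\}$ and edges $e_i\in F_i$ for $i\in I$, such that $e_i$ and $e_j$ share no vertex (in particular are distinct) whenever $i\neq j$. A rainbow matching is full if an edge is chosen from every one of the $F_i$'s, i.e. $I=\{1,\ldots,n\}$. *)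

theory Defs
  imports Complex_Main
begin

text \<open>A simple graph is a vertex set \<open>V\<close> with a set \<open>E\<close> of edges, an edge being the
  two-element set of its ends. Neither \<open>V\<close> nor \<open>E\<close> is required to be finite.\<close>

definition graph :: "'a set \<Rightarrow> 'a set set \<Rightarrow> bool" where
  "graph V E \<longleftrightarrow> (\<forall>e\<in>E. e \<subseteq> V \<and> card e = 2)"

definition bipartite_graph :: "'a set \<Rightarrow> 'a set set \<Rightarrow> bool" where
  "bipartite_graph V E \<longleftrightarrow> graph V E \<and>
     (\<exists>A B. A \<union> B = V \<and> A \<inter> B = {} \<and> (\<forall>e\<in>E. \<exists>a\<in>A. \<exists>b\<in>B. e = {a, b}))"

definition matching_in :: "'a set set \<Rightarrow> 'a set set \<Rightarrow> bool" where
  "matching_in E M \<longleftrightarrow> M \<subseteq> E \<and> pairwise disjnt M"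

text \<open>The family \<open>F\<close> is indexed by \<open>{1..n}\<close>, so repetitions among the \<open>F i\<close> are allowed; values
  of \<open>F\<close> outside this range are irrelevant. The index set \<open>I\<close> says which members are
  represented, and \<open>e i\<close> is the edge chosen from \<open>F i\<close>. Since edges are nonempty, disjoint
  edges are distinct.\<close>

definition rainbow_matching ::
    "nat \<Rightarrow> (nat \<Rightarrow> 'a set set) \<Rightarrow> nat set \<Rightarrow> (nat \<Rightarrow> 'a set) \<Rightarrow> bool" where
  "rainbow_matching n F I e \<longleftrightarrow> I \<subseteq> {1..n} \<and> (\<forall>i\<in>I. e i \<in> F i) \<and>
     (\<forall>i\<in>I. \<forall>j\<in>I. i \<noteq> j \<longrightarrow> disjnt (e i) (e j))"

definition full_rainbow_matching ::
    "nat \<Rightarrow> (nat \<Rightarrow> 'a set set) \<Rightarrow> (nat \<Rightarrow> 'a set) \<Rightarrow> bool" where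
  "full_rainbow_matching n F e \<longleftrightarrow> rainbow_matching n F {1..n} e"

end

theory Submission
  imports Defs
begin

text \<open>
  The proof is by induction on the number of matchings, with exchange chains of unbounded length
  in the induction step. Orient every edge as a pair, with its first end in one side of the
  bipartite graph and its second end in the other.

  Let \<open>q\<close> of the \<open>q + 1\<close> matchings, those indexed by \<open>N\<close>, have a rainbow matching with edges
  \<open>(a j, b j)\<close>, and let \<open>c\<close> be the remaining index. Call a vertex free if it is on none of these
  edges. A chain starts at \<open>s 0 = c\<close>; the matching \<open>s k\<close> takes over from \<open>s (k + 1)\<close> by using one
  end of its chosen edge, and so leaves \<open>s (k + 1)\<close> without an edge. It can do so in two ways: by
  \<open>(a (s (k + 1)), y k)\<close>, with a free label \<open>y k\<close> that is new at each stage, or by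
  \<open>(z k, b (s (k + 1)))\<close>, where \<open>z k\<close> is free or was released at an earlier stage. After \<open>m\<close> stages
  only \<open>s m\<close> lacks an edge. If no full rainbow matching exists, then every edge of \<open>M (s m)\<close> meets
  each rainbow matching obtained in this way. Using the labels \<open>y\<close> at all stages excludes the edges
  from a free vertex to \<open>b (s k)\<close> or to a free vertex that is not a label; using \<open>z\<close> at the stages
  that lead to the release of \<open>a (s k)\<close> excludes the edges from \<open>a (s k)\<close> to such free vertices
  (\<open>free_edge_of_last\<close>, \<open>released_edge_of_last\<close>).

  If moreover the chain cannot be prolonged, double counting of the edges of \<open>M (s m)\<close>, each of
  the matchings having \<open>f\<close> edges, yields \<open>2 * f \<le> 3 * q + r\<close>, where \<open>r\<close> is the number of edges of
  \<open>M (s m)\<close> from a free vertex to a label. To bound \<open>r\<close>, let \<open>(x, y k)\<close> be such an edge with \<open>k\<close>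
  least, so that \<open>r \<le> m - k\<close>. Giving \<open>(x, y k)\<close> to \<open>s m\<close> turns the chain after stage \<open>k\<close> into a
  cycle: \<open>c\<close> is again the only index without an edge, and all of the \<open>m - k\<close> vertices \<open>b (s l)\<close> with
  \<open>k < l \<le> m\<close> can be released. Hence \<open>M c\<close> has no edge from a free vertex other than \<open>x\<close> to any of
  these, which leaves it at most \<open>2 * q + 1 - (m - k)\<close> edges, so \<open>r + f \<le> 2 * q + 1\<close>
  (\<open>dead_after_cycle\<close>, \<open>card_reused_labels\<close>). Adding the two inequalities gives
  \<open>3 * f \<le> 5 * q + 1\<close>, which fails for \<open>q + 1\<close> matchings of size \<open>f = \<lfloor>5 / 3 * (q + 1)\<rfloor>\<close>. So every
  chain can be prolonged (\<open>ex_extension\<close>), although a chain has at most \<open>q\<close> stages.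
\<close>

section \<open>Rainbow systems of oriented edges\<close>

text \<open>The two injectivity conditions say that the chosen pairs are disjoint as edges of a bipartite
  graph, since first and second components lie on different sides.\<close>

definition rainbow_pairs :: "('i \<Rightarrow> ('a \<times> 'b) set) \<Rightarrow> 'i set \<Rightarrow> ('i \<Rightarrow> 'a \<times> 'b) \<Rightarrow> bool" where
  "rainbow_pairs M N e \<longleftrightarrow>
     (\<forall>i\<in>N. e i \<in> M i) \<and> inj_on (fst \<circ> e) N \<and> inj_on (snd \<circ> e) N"

lemma finite_preimage:
  assumes "inj_on f F" "finite T"
  shows "finite {e \<in> F. f e \<in> T}"
proof (rule inj_on_finite[of f _ T])
  show "inj_on f {e \<in> F. f e \<in> T}" using assms(1) by (rule inj_on_subset) auto
qed (use assms in auto)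

lemma card_preimage_le:
  assumes "inj_on f F" "finite T"
  shows "card {e \<in> F. f e \<in> T} \<le> card T"
proof (rule card_inj_on_le[of f])
  show "inj_on f {e \<in> F. f e \<in> T}" using assms(1) by (rule inj_on_subset) auto
qed (use assms in auto)

lemma image_of_hits: "X \<subseteq> f ` T \<Longrightarrow> X = f ` {j \<in> T. f j \<in> X}"
  by auto

section \<open>Exchange chains\<close>

text \<open>The situation of the induction step in a proof by contradiction: \<open>(a j, b j)\<close> is the edge chosen
  from \<open>M j\<close>, and the index \<open>c\<close> cannot be accommodated, even by a different choice.\<close>

locale unextendable_rainbow =
  fixes M :: "'i \<Rightarrow> ('a \<times> 'b) set" and N :: "'i set" and c :: 'i
    and a :: "'i \<Rightarrow> 'a" and b :: "'i \<Rightarrow> 'b"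
  assumes finite_N: "finite N" and c_notin: "c \<notin> N"
    and chosen: "\<And>j. j \<in> N \<Longrightarrow> (a j, b j) \<in> M j"
    and inj_a: "inj_on a N" and inj_b: "inj_on b N"
    and inj_fst: "\<And>i. i \<in> insert c N \<Longrightarrow> inj_on fst (M i)"
    and inj_snd: "\<And>i. i \<in> insert c N \<Longrightarrow> inj_on snd (M i)"
    and no_full: "\<And>e. \<not> rainbow_pairs M (insert c N) e"
begin

text \<open>Stage \<open>k\<close> of a chain offers the matching \<open>s k\<close> two edges, one at each end of the edge chosen for
  \<open>s (Suc k)\<close>. The labels \<open>y\<close> are free and distinct, so that all stages can use them at once. The
  vertices \<open>z\<close> need not be distinct, and they may be ends \<open>a (s (Suc l))\<close> that an earlier stage
  \<open>l\<close> makes available by using \<open>z l\<close> in place of \<open>y l\<close>. This asymmetry is what keeps a chain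
  easy to prolong: only one side has to provide new vertices.\<close>

definition chain :: "nat \<Rightarrow> (nat \<Rightarrow> 'i) \<Rightarrow> (nat \<Rightarrow> 'b) \<Rightarrow> (nat \<Rightarrow> 'a) \<Rightarrow> bool" where
  "chain m s y z \<longleftrightarrow>
     s 0 = c \<and> inj_on s {..m} \<and> s ` {1..m} \<subseteq> N \<and> inj_on y {..<m} \<and>
     (\<forall>k<m. y k \<notin> b ` N \<and> (a (s (Suc k)), y k) \<in> M (s k) \<and>
            (z k, b (s (Suc k))) \<in> M (s k) \<and>
            (z k \<in> a ` N \<longrightarrow> (\<exists>l<k. z k = a (s (Suc l)))))"

lemma chain_in_N:
  assumes "chain m s y z" "k < m"
  shows "s (Suc k) \<in> N"
  using assms unfolding chain_def by (auto simp: image_subset_iff)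

lemma chain_color:
  assumes "chain m s y z" "k \<le> m"
  shows "s k \<in> insert c N"
  using assms chain_in_N[OF assms(1), of "k - 1"] by (cases k) (auto simp: chain_def)

lemma chain_a_eq_iff:
  assumes "chain m s y z" "k < m" "l < m"
  shows "a (s (Suc k)) = a (s (Suc l)) \<longleftrightarrow> k = l"
proof
  assume "a (s (Suc k)) = a (s (Suc l))"
  then have "s (Suc k) = s (Suc l)"
    using inj_a chain_in_N[OF assms(1)] assms by (auto dest: inj_onD)
  then show "k = l"
    using assms unfolding chain_def by (auto dest!: inj_onD[of s "{..m}"])
qed auto

lemma chain_b_eq_iff:
  assumes "chain m s y z" "k < m" "l < m"
  shows "b (s (Suc k)) = b (s (Suc l)) \<longleftrightarrow> k = l"
proof
  assume "b (s (Suc k)) = b (s (Suc l))"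
  then have "s (Suc k) = s (Suc l)"
    using inj_b chain_in_N[OF assms(1)] assms by (auto dest: inj_onD)
  then show "k = l"
    using assms unfolding chain_def by (auto dest!: inj_onD[of s "{..m}"])
qed auto

text \<open>Only the edges chosen for indices of the chain are given up, so a system of pairs for the
  indices of the chain completes the other chosen edges to a full rainbow matching as soon as it
  uses no vertices but free ones and ends of the edges given up.\<close>

lemma chain_no_recolouring:
  assumes ch: "chain m s y z"
    and g: "\<And>k. k \<le> m \<Longrightarrow> g k \<in> M (s k)"
    and inj1: "inj_on (fst \<circ> g) {..m}" and inj2: "inj_on (snd \<circ> g) {..m}"
    and fst_g: "\<And>k. k \<le> m \<Longrightarrow> fst (g k) \<in> a ` N \<Longrightarrow> \<exists>l<m. fst (g k) = a (s (Suc l))"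
    and snd_g: "\<And>k. k \<le> m \<Longrightarrow> snd (g k) \<in> b ` N \<Longrightarrow> \<exists>l<m. snd (g k) = b (s (Suc l))"
  shows False
proof -
  let ?K = "s ` {..m}"
  define p where "p = the_inv_into {..m} s"
  define e where "e = (\<lambda>i. if i \<in> ?K then g (p i) else (a i, b i))"
  have inj_s: "inj_on s {..m}" using ch by (simp add: chain_def)
  have p: "p (s k) = k" if "k \<le> m" for k
    using the_inv_into_f_f[OF inj_s] that by (simp add: p_def)
  have e_s: "e (s k) = g k" if "k \<le> m" for k
    using that p by (auto simp: e_def)
  have e_r: "e j = (a j, b j)" if "j \<in> N - ?K" for j
    using that by (auto simp: e_def)
  have KN: "insert c N = ?K \<union> (N - ?K)"
    using ch chain_color[OF ch] by (auto simp: chain_def)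
  have injK: "inj_on (h \<circ> e) ?K" if "inj_on (h \<circ> g) {..m}" for h :: "'a \<times> 'b \<Rightarrow> 'x"
    using that e_s by (auto simp: inj_on_def)
  have in_chain: "s (Suc l) \<in> ?K" if "l < m" for l using that by auto
  have "inj_on (fst \<circ> e) (insert c N)"
  proof -
    have "inj_on (fst \<circ> e) (N - ?K)"
      using inj_a e_r by (auto simp: inj_on_def)
    moreover have "fst (e i) \<noteq> fst (e j)" if i: "i \<in> ?K" and j: "j \<in> N - ?K" for i j
    proof
      assume eq: "fst (e i) = fst (e j)"
      obtain k where k: "k \<le> m" "i = s k" using i by auto
      have "fst (g k) = a j" using eq k e_s e_r[OF j] by simp
      then obtain l where l: "l < m" "a j = a (s (Suc l))" using fst_g[OF k(1)] j by auto
      then have "j = s (Suc l)" using inj_a j chain_in_N[OF ch] by (auto dest: inj_onD)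
      then show False using j in_chain l by auto
    qed
    ultimately show ?thesis
      unfolding KN inj_on_Un using injK[OF inj1] by fastforce
  qed
  moreover have "inj_on (snd \<circ> e) (insert c N)"
  proof -
    have "inj_on (snd \<circ> e) (N - ?K)"
      using inj_b e_r by (auto simp: inj_on_def)
    moreover have "snd (e i) \<noteq> snd (e j)" if i: "i \<in> ?K" and j: "j \<in> N - ?K" for i j
    proof
      assume eq: "snd (e i) = snd (e j)"
      obtain k where k: "k \<le> m" "i = s k" using i by auto
      have "snd (g k) = b j" using eq k e_s e_r[OF j] by simp
      then obtain l where l: "l < m" "b j = b (s (Suc l))" using snd_g[OF k(1)] j by auto
      then have "j = s (Suc l)" using inj_b j chain_in_N[OF ch] by (auto dest: inj_onD)
      then show False using j in_chain l by auto
    qed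
    ultimately show ?thesis
      unfolding KN inj_on_Un using injK[OF inj2] by fastforce
  qed
  moreover have "\<forall>i\<in>insert c N. e i \<in> M i"
  proof
    fix i assume "i \<in> insert c N"
    then consider k where "k \<le> m" "i = s k" | "i \<in> N - ?K" unfolding KN by blast
    then show "e i \<in> M i" using e_s e_r g chosen by cases auto
  qed
  ultimately show False using no_full[of e] by (simp add: rainbow_pairs_def)
qed

text \<open>Here \<open>S\<close> is the set of stages that use \<open>z\<close>, while the others use \<open>y\<close>. Stage \<open>l\<close> then
  releases \<open>a (s (Suc l))\<close> if \<open>l \<in> S\<close> and \<open>b (s (Suc l))\<close> otherwise; an edge \<open>(u, v)\<close> of the last
  matching between vertices that are available after this would complete a full rainbow
  matching.\<close>

lemma chain_no_edge:
  assumes ch: "chain m s y z"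
    and S: "S \<subseteq> {..<m}" "inj_on z S"
    and closed: "\<And>k. k \<in> S \<Longrightarrow> z k \<in> a ` N \<Longrightarrow> \<exists>l\<in>S. z k = a (s (Suc l))"
    and u: "u \<notin> z ` S" "u \<in> a ` N \<Longrightarrow> \<exists>l\<in>S. u = a (s (Suc l))"
    and v: "v \<notin> y ` {..<m}" "v \<in> b ` N \<Longrightarrow> \<exists>l\<in>{..<m} - S. v = b (s (Suc l))"
  shows "(u, v) \<notin> M (s m)"
proof
  assume uv: "(u, v) \<in> M (s m)"
  define g where "g = (\<lambda>k. if k = m then (u, v)
     else if k \<in> S then (z k, b (s (Suc k))) else (a (s (Suc k)), y k))"
  note a_iff = chain_a_eq_iff[OF ch] and b_iff = chain_b_eq_iff[OF ch]
  have aN: "a (s (Suc k)) \<in> a ` N" and bN: "b (s (Suc k)) \<in> b ` N" if "k < m" for k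
    using chain_in_N[OF ch that] by auto
  have yN: "y k \<notin> b ` N" if "k < m" for k using ch that by (auto simp: chain_def)
  have Sm: "k < m" if "k \<in> S" for k using S(1) that by auto
  have inj_y: "y k = y l \<longleftrightarrow> k = l" if "k < m" "l < m" for k l
    using ch that by (auto simp: chain_def dest: inj_onD)
  have za: "z k \<noteq> a (s (Suc l))" if "k \<in> S" "l < m" "l \<notin> S" for k l
    using closed[OF that(1)] aN[OF that(2)] a_iff[OF that(2)] Sm that(3) by metis
  have ua: "u \<noteq> a (s (Suc l))" if "l < m" "l \<notin> S" for l
    using u(2) aN[OF that(1)] a_iff[OF that(1)] Sm that(2) by metis
  have vb: "v \<noteq> b (s (Suc l))" if "l \<in> S" for l
    using v(2) bN[OF Sm[OF that]] b_iff[OF Sm[OF that]] that by (metis DiffE lessThan_iff)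
  have yb: "y k \<noteq> b (s (Suc l))" if "k < m" "l < m" for k l
    using yN[OF that(1)] bN[OF that(2)] by metis
  show False
  proof (rule chain_no_recolouring[OF ch, of g])
    show "g k \<in> M (s k)" if "k \<le> m" for k
      using that ch uv by (auto simp: g_def chain_def)
    have "fst (g k) \<noteq> fst (g l)" if "k < l" "l \<le> m" for k l
    proof -
      have km: "k < m" using that by simp
      show ?thesis
        using that km a_iff[of k l] za[of k l] za[of l k] ua[of k] u(1) inj_onD[OF S(2), of k l]
        by (auto simp: g_def)
    qed
    then show "inj_on (fst \<circ> g) {..m}"
      by (auto simp: inj_on_def) (metis nat_neq_iff)
    have "snd (g k) \<noteq> snd (g l)" if "k < l" "l \<le> m" for k l
    proof -
      have km: "k < m" using that by simp
      show ?thesis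
        using that km b_iff[of k l] yb[of k l] yb[of l k] vb[of k] v(1) inj_y[of k l]
        by (auto simp: g_def)
    qed
    then show "inj_on (snd \<circ> g) {..m}"
      by (auto simp: inj_on_def) (metis nat_neq_iff)
    show "\<exists>l<m. fst (g k) = a (s (Suc l))" if "k \<le> m" "fst (g k) \<in> a ` N" for k
      using that u(2) closed[of k] Sm unfolding g_def
      by (cases "k = m"; cases "k \<in> S") (fastforce intro: exI[of _ k])+
    show "\<exists>l<m. snd (g k) = b (s (Suc l))" if "k \<le> m" "snd (g k) \<in> b ` N" for k
      using that v(2) yN[of k] unfolding g_def
      by (cases "k = m"; cases "k \<in> S") (fastforce intro: exI[of _ k])+
  qed
qed

section \<open>Edges excluded from the last matching of a chain\<close>

text \<open>To release \<open>a (s (Suc k))\<close>, stage \<open>k\<close> must use \<open>z k\<close>, which may in turn have to be released at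
  an earlier stage. Tracing this back until a free vertex is reached gives \<open>S\<close>. The vertices used
  are distinct because the stages that release them decrease.\<close>

lemma release_a:
  assumes ch: "chain m s y z" and "k < m"
  shows "\<exists>S. S \<subseteq> {..k} \<and> k \<in> S \<and> inj_on z S \<and> a (s (Suc k)) \<notin> z ` S \<and>
     (\<forall>j\<in>S. z j \<in> a ` N \<longrightarrow> (\<exists>l\<in>S. z j = a (s (Suc l))))"
  using \<open>k < m\<close>
proof (induction k rule: less_induct)
  case (less k)
  have aN: "a (s (Suc k)) \<in> a ` N" using chain_in_N[OF ch less.prems] by auto
  show ?case
  proof (cases "z k \<in> a ` N")
    case False
    then show ?thesis using aN by (intro exI[of _ "{k}"]) auto
  next
    case True
    then obtain l where l: "l < k" "z k = a (s (Suc l))"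
      using ch less.prems by (auto simp: chain_def)
    with less.IH[of l] less.prems obtain S where S: "S \<subseteq> {..l}" "l \<in> S" "inj_on z S"
      "z k \<notin> z ` S" "\<forall>j\<in>S. z j \<in> a ` N \<longrightarrow> (\<exists>l\<in>S. z j = a (s (Suc l)))" by auto
    have "a (s (Suc k)) \<noteq> z j" if j: "j \<in> insert k S" for j
    proof
      assume eq: "a (s (Suc k)) = z j"
      then have "\<exists>i\<in>S. z j = a (s (Suc i))" using j S l aN by auto
      then obtain i where i: "i \<in> S" "a (s (Suc k)) = a (s (Suc i))" using eq by auto
      then have "i \<le> l" using S by auto
      then show False using i chain_a_eq_iff[OF ch less.prems, of i] l less.prems by auto
    qed
    then have "a (s (Suc k)) \<notin> z ` insert k S" by blast
    moreover have "inj_on z (insert k S)" using S(3,4) by auto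
    moreover have "insert k S \<subseteq> {..k}" using S(1) l(1) by auto
    ultimately show ?thesis using S(2,5) l(2) by (intro exI[of _ "insert k S"]) blast
  qed
qed

text \<open>All stages use their labels, that is \<open>S = {}\<close>: free vertices of the first side stay available,
  and every \<open>b (s k)\<close> is released.\<close>

lemma free_edge_of_last:
  assumes ch: "chain m s y z" and uv: "(u, v) \<in> M (s m)" and u: "u \<notin> a ` N"
  shows "v \<in> y ` {..<m} \<or> v \<in> b ` (N - s ` {1..m})"
proof (rule ccontr)
  assume *: "\<not> ?thesis"
  have "\<exists>l\<in>{..<m} - {}. v = b (s (Suc l))" if "v \<in> b ` N"
  proof -
    have "v \<in> b ` s ` {1..m}" using * that by auto
    then obtain k where k: "1 \<le> k" "k \<le> m" "v = b (s k)" by auto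
    then show ?thesis by (intro bexI[of _ "k - 1"]) auto
  qed
  then have "(u, v) \<notin> M (s m)"
    using chain_no_edge[OF ch, of "{}" u v] u * by auto
  then show False using uv by simp
qed

lemma released_edge_of_last:
  assumes ch: "chain m s y z" and uv: "(a (s (Suc k)), v) \<in> M (s m)" and k: "k < m"
  shows "v \<in> y ` {..<m} \<or> v \<in> b ` N"
proof (rule ccontr)
  assume *: "\<not> ?thesis"
  obtain S where S: "S \<subseteq> {..k}" "k \<in> S" "inj_on z S" "a (s (Suc k)) \<notin> z ` S"
     "\<forall>j\<in>S. z j \<in> a ` N \<longrightarrow> (\<exists>l\<in>S. z j = a (s (Suc l)))"
    using release_a[OF ch k] by auto
  have "(a (s (Suc k)), v) \<notin> M (s m)"
    by (rule chain_no_edge[OF ch, of S]) (use S k * in auto)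
  then show False using uv by simp
qed

section \<open>Labels reused by the last matching\<close>

text \<open>An edge \<open>(x, y k)\<close> of the last matching competes with stage \<open>k\<close> for the label \<open>y k\<close>. If the last
  matching takes it, stages \<open>k + 1, \<dots>, m - 1\<close> can still be carried out with their labels, and the
  matching \<open>s (Suc k)\<close> gives up its edge without needing stage \<open>k\<close>. The indices
  \<open>s (Suc k), \<dots>, s m\<close> thus exchange edges among themselves and release \<open>b (s (Suc l))\<close> for
  \<open>k \<le> l < m\<close>, while the earlier indices of the chain keep their edges and \<open>c\<close> still lacks one.\<close>

lemma dead_after_cycle:
  assumes ch: "chain m s y z"
    and k: "k < m" "(x, y k) \<in> M (s m)" "x \<notin> a ` N"
    and l: "k \<le> l" "l < m" and x': "x' \<notin> a ` N" "x' \<noteq> x"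
  shows "(x', b (s (Suc l))) \<notin> M c"
proof
  assume x'l: "(x', b (s (Suc l))) \<in> M c"
  define g where "g = (\<lambda>i. if i = m then (x, y k) else if i = 0 then (x', b (s (Suc l)))
     else if i \<le> k then (a (s i), b (s i)) else (a (s (Suc i)), y i))"
  \<comment> \<open>For \<open>0 < i < m\<close> the first end of \<open>g i\<close> is \<open>a (s (Suc (h i)))\<close>, in both cases of \<open>g\<close>.
    As \<open>h\<close> skips \<open>k\<close>, the vertex \<open>a (s (Suc k))\<close> remains unused.\<close>
  define h where "h = (\<lambda>i. if i \<le> k then i - 1 else i)"
  note a_iff = chain_a_eq_iff[OF ch] and b_iff = chain_b_eq_iff[OF ch]
  have aN: "a (s (Suc i)) \<in> a ` N" and bN: "b (s (Suc i)) \<in> b ` N" if "i < m" for i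
    using chain_in_N[OF ch that] by auto
  have yN: "y i \<notin> b ` N" if "i < m" for i using ch that by (auto simp: chain_def)
  have inj_y: "y i = y j \<longleftrightarrow> i = j" if "i < m" "j < m" for i j
    using ch that by (auto simp: chain_def dest: inj_onD)
  have yb: "y i \<noteq> b (s (Suc j))" if "i < m" "j < m" for i j
    using yN[OF that(1)] bN[OF that(2)] by metis
  have fst_mid: "fst (g i) = a (s (Suc (h i)))" "h i < m" if "0 < i" "i < m" for i
    using that k(1) by (auto simp: g_def h_def)
  have snd_mid: "snd (g i) = (if i \<le> k then b (s (Suc (i - 1))) else y i)" if "0 < i" "i < m" for i
    using that by (auto simp: g_def)
  have g0: "g 0 = (x', b (s (Suc l)))" and gm: "g m = (x, y k)"
    using k(1) by (auto simp: g_def)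
  have s0: "s 0 = c" using ch by (simp add: chain_def)
  show False
  proof (rule chain_no_recolouring[OF ch, of g])
    show "g i \<in> M (s i)" if "i \<le> m" for i
    proof -
      have "(a (s i), b (s i)) \<in> M (s i)" if "0 < i"
        using chosen chain_in_N[OF ch, of "i - 1"] that \<open>i \<le> m\<close> by auto
      then show ?thesis using that ch k x'l s0 by (auto simp: g_def chain_def)
    qed
    have "fst (g i) \<noteq> fst (g j)" if ij: "i < j" "j \<le> m" for i j
    proof -
      have xa: "x \<noteq> a (s (Suc (h i)))" "x' \<noteq> a (s (Suc (h i)))" if "0 < i" "i < m" for i
        using k(3) x'(1) aN fst_mid(2)[OF that] by metis+
      have "h i \<noteq> h j" if "0 < i" using ij that by (auto simp: h_def)
      then show ?thesis
        using ij xa[of i] xa[of j] fst_mid[of i] fst_mid[of j] a_iff[of "h i" "h j"] g0 gm x'(2)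
        by (cases "i = 0"; cases "j = m") (auto dest: sym)
    qed
    then show "inj_on (fst \<circ> g) {..m}"
      by (auto simp: inj_on_def) (metis nat_neq_iff)
    have "snd (g i) \<noteq> snd (g j)" if ij: "i < j" "j \<le> m" for i j
    proof -
      have "snd (g i) \<noteq> snd (g m)" if "i < m"
        using that less_imp_diff_less[OF that, of 1] k(1) l yb[of k l] yb[of k "i - 1"] inj_y[of i k] snd_mid[of i] g0 gm
        by (cases "i = 0") auto
      moreover have "snd (g 0) \<noteq> snd (g j)" if "0 < j" "j < m"
        using that k(1) l b_iff[of l "j - 1"] yb[of j l] snd_mid[of j] g0 by auto
      moreover have "snd (g i) \<noteq> snd (g j)" if "0 < i" "j < m"
        using that ij k(1) less_imp_diff_less[of i m 1] less_imp_diff_less[of j m 1]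
          b_iff[of "i - 1" "j - 1"] yb[of j "i - 1"] inj_y[of i j]
          snd_mid[of i] snd_mid[of j] by auto
      ultimately show ?thesis using ij by (cases "i = 0"; cases "j = m") auto
    qed
    then show "inj_on (snd \<circ> g) {..m}"
      by (auto simp: inj_on_def) (metis nat_neq_iff)
    show "\<exists>l<m. fst (g i) = a (s (Suc l))" if "i \<le> m" "fst (g i) \<in> a ` N" for i
      using that fst_mid[of i] g0 gm k(3) x'(1) by (cases "i = 0"; cases "i = m") auto
    show "\<exists>l<m. snd (g i) = b (s (Suc l))" if "i \<le> m" "snd (g i) \<in> b ` N" for i
    proof -
      consider "i = 0" | "i = m" | "0 < i" "i < m" using \<open>i \<le> m\<close> by linarith
      then show ?thesis
      proof cases
        case 1
        then show ?thesis using g0 l(2) by auto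
      next
        case 2
        then show ?thesis using gm yN[OF k(1)] that(2) by simp
      next
        case 3
        then have "snd (g i) = b (s (Suc (i - 1)))"
          using snd_mid yN that(2) by (metis)
        then show ?thesis using 3 by (intro exI[of _ "i - 1"]) auto
      qed
    qed
  qed
qed

lemma chain_0: "chain 0 (\<lambda>_. c) y z"
  by (simp add: chain_def)

lemma card_chain_indices:
  assumes "chain m s y z"
  shows "card (s ` {1..m}) = m" "m \<le> card N"
proof -
  have "inj_on s {..m}" using assms by (simp add: chain_def)
  then have "inj_on s {1..m}" by (rule inj_on_subset) auto
  then show 1: "card (s ` {1..m}) = m" by (simp add: card_image)
  have "s ` {1..m} \<subseteq> N" using assms by (simp add: chain_def)
  then show "m \<le> card N" using card_mono[OF finite_N] 1 by metis
qed

text \<open>Many reused labels make \<open>M c\<close> small: with \<open>k\<close> the first stage whose label is reused, the number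
  of reused labels is at most \<open>m - k\<close>, and by \<open>dead_after_cycle\<close> there are as many vertices
  \<open>b j\<close> that \<open>M c\<close> joins to no free vertex other than \<open>x\<close>. The summand \<open>1\<close> accounts for \<open>x\<close>.\<close>

lemma card_reused_labels:
  assumes ch: "chain m s y z" and fin: "finite (M c)"
  shows "card {e \<in> M (s m). fst e \<notin> a ` N \<and> snd e \<in> y ` {..<m}} + card (M c) \<le> 2 * card N + 1"
proof -
  define R where "R = {e \<in> M (s m). fst e \<notin> a ` N \<and> snd e \<in> y ` {..<m}}"
  define L where "L = {k. k < m \<and> (\<exists>x. x \<notin> a ` N \<and> (x, y k) \<in> M (s m))}"
  let ?A = "{e \<in> M c. fst e \<in> a ` N}"
  have finL: "finite L" by (simp add: L_def)
  have inj1: "inj_on fst (M c)" and inj2: "inj_on snd (M c)"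
    using inj_fst inj_snd by auto
  have card_A: "card ?A \<le> card N"
    using card_preimage_le[OF inj1, of "a ` N"] card_image_le[OF finite_N, of a] finite_N by simp
  have B: "snd e \<in> b ` N" if "e \<in> M c" "fst e \<notin> a ` N" for e
    using free_edge_of_last[OF chain_0, of "fst e" "snd e"] that by auto
  have "R \<subseteq> {e \<in> M (s m). snd e \<in> y ` L}"
    unfolding R_def L_def by force
  moreover have "card {e \<in> M (s m). snd e \<in> y ` L} \<le> card (y ` L)"
    and "finite {e \<in> M (s m). snd e \<in> y ` L}"
    using card_preimage_le[OF inj_snd[OF chain_color[OF ch order_refl]]]
      finite_preimage[OF inj_snd[OF chain_color[OF ch order_refl]]] finL by blast+
  ultimately have RL: "card R \<le> card L"
    using card_mono card_image_le[OF finL, of y] by (meson order_trans)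
  show ?thesis
  proof (cases "L = {}")
    case True
    \<comment> \<open>No edge of \<open>M c\<close> joins two free vertices.\<close>
    have "M c \<subseteq> ?A \<union> {e \<in> M c. snd e \<in> b ` N}" using B by auto
    then have "card (M c) \<le> card ?A + card {e \<in> M c. snd e \<in> b ` N}"
      using fin by (auto intro!: order_trans[OF card_mono card_Un_le])
    also have "\<dots> \<le> card N + card N"
      using card_A card_preimage_le[OF inj2, of "b ` N"] card_image_le[OF finite_N, of b] finite_N
      by simp
    finally show ?thesis using RL True by (simp add: R_def)
  next
    case False
    define k where "k = Min L"
    have "k \<in> L" using False finL by (simp add: k_def)
    then obtain x where k: "k < m" "x \<notin> a ` N" "(x, y k) \<in> M (s m)" by (auto simp: L_def)
    have "L \<subseteq> {k..<m}" using finL Min_le[OF finL] by (auto simp: k_def) (simp add: L_def)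
    then have Lk: "card L \<le> m - k" using card_mono[of "{k..<m}" L] by simp
    let ?D = "(\<lambda>l. s (Suc l)) ` {k..<m}"
    let ?B = "{e \<in> M c. snd e \<in> b ` (N - ?D)}"
    let ?X = "{e \<in> M c. fst e \<in> {x}}"
    have "e \<in> ?A \<union> ?X \<union> ?B" if e: "e \<in> M c" for e
    proof (cases "fst e \<in> a ` N \<or> fst e = x")
      case False
      then obtain j where j: "j \<in> N" "snd e = b j" using B[OF e] by blast
      have "j \<notin> ?D"
      proof
        assume "j \<in> ?D"
        then obtain l where l: "k \<le> l" "l < m" "j = s (Suc l)" by auto
        have "(fst e, b (s (Suc l))) \<notin> M c"
          using dead_after_cycle[OF ch k(1,3,2) l(1,2)] False by simp
        then show False using e j(2) l(3) by (metis prod.collapse)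
      qed
      then show ?thesis using that j by auto
    qed (use that in auto)
    then have "M c \<subseteq> ?A \<union> ?X \<union> ?B" by blast
    then have "card (M c) \<le> card (?A \<union> ?X \<union> ?B)" using fin by (auto intro: card_mono)
    also have "\<dots> \<le> card ?A + card ?X + card ?B"
      by (meson card_Un_le order_trans add_right_mono)
    also have "card ?X \<le> 1" using card_preimage_le[OF inj1, of "{x}"] by simp
    also have "card ?B \<le> card (N - ?D)"
      using card_preimage_le[OF inj2, of "b ` (N - ?D)"] card_image_le[of "N - ?D" b] finite_N
      by simp
    also have "card (N - ?D) = card N - (m - k)"
    proof -
      have "inj_on (\<lambda>l. s (Suc l)) {k..<m}"
      proof (rule inj_onI)
        fix i j assume "i \<in> {k..<m}" "j \<in> {k..<m}" "s (Suc i) = s (Suc j)"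
        then show "i = j" using ch by (auto simp: chain_def dest!: inj_onD[of s "{..m}"])
      qed
      then have "card ?D = m - k" by (simp add: card_image)
      moreover have "?D \<subseteq> N" using chain_in_N[OF ch] by auto
      ultimately show ?thesis by (simp add: card_Diff_subset finite_subset[OF _ finite_N])
    qed
    finally show ?thesis
      using RL Lk card_A card_chain_indices(2)[OF ch] unfolding R_def by linarith
  qed
qed

section \<open>Prolonging a chain\<close>

lemma chain_extend:
  assumes ch: "chain m s y z" and j: "j \<in> N - s ` {1..m}"
    and y': "(a j, y') \<in> M (s m)" "y' \<notin> y ` {..<m}" "y' \<notin> b ` N"
    and z': "(z', b j) \<in> M (s m)" "z' \<in> a ` N \<Longrightarrow> z' \<in> a ` s ` {1..m}"
  shows "chain (Suc m) (s(Suc m := j)) (y(m := y')) (z(m := z'))"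
proof -
  have s0: "s 0 = c" and inj_s: "inj_on s {..m}" and sN: "s ` {1..m} \<subseteq> N"
    and inj_y: "inj_on y {..<m}" using ch by (auto simp: chain_def)
  have jK: "j \<notin> s ` {..m}"
  proof
    assume "j \<in> s ` {..m}"
    then obtain k where "k \<le> m" "j = s k" by auto
    then show False using j s0 c_notin by (cases "k = 0") auto
  qed
  let ?s = "s(Suc m := j)"
  have z: "z' \<in> a ` N \<longrightarrow> (\<exists>l<m. z' = a (s (Suc l)))"
  proof
    assume "z' \<in> a ` N"
    then obtain k where "1 \<le> k" "k \<le> m" "z' = a (s k)" using z'(2) by auto
    then show "\<exists>l<m. z' = a (s (Suc l))" by (intro exI[of _ "k - 1"]) auto
  qed
  have "inj_on (s(Suc m := j)) {..Suc m}"
    using inj_s jK by (auto simp: inj_on_def atMost_Suc)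
  moreover have "inj_on (y(m := y')) {..<Suc m}"
    using inj_y y'(2) by (auto simp: inj_on_def lessThan_Suc)
  moreover have "(s(Suc m := j)) ` {1..Suc m} \<subseteq> N"
    using sN j by (auto simp: image_subset_iff)
  moreover have "(y(m := y')) k \<notin> b ` N \<and> (a (?s (Suc k)), (y(m := y')) k) \<in> M (?s k) \<and>
      ((z(m := z')) k, b (?s (Suc k))) \<in> M (?s k) \<and>
      ((z(m := z')) k \<in> a ` N \<longrightarrow> (\<exists>l<k. (z(m := z')) k = a (?s (Suc l))))" if "k < Suc m" for k
  proof (cases "k = m")
    case True
    then show ?thesis using y' z'(1) z by auto
  next
    case False
    then have "k < m" using that by simp
    then have "y k \<notin> b ` N \<and> (a (s (Suc k)), y k) \<in> M (s k) \<and> (z k, b (s (Suc k))) \<in> M (s k) \<and>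
      (z k \<in> a ` N \<longrightarrow> (\<exists>l<k. z k = a (s (Suc l))))"
      using ch by (simp add: chain_def)
    moreover have "?s (Suc l) = s (Suc l)" if "l \<le> k" for l
      using that \<open>k < m\<close> by simp
    moreover have "?s k = s k" "(y(m := y')) k = y k" "(z(m := z')) k = z k"
      using \<open>k < m\<close> by simp_all
    ultimately show ?thesis by (metis less_imp_le order_refl)
  qed
  ultimately show ?thesis
    using s0 unfolding chain_def by simp
qed

text \<open>A chain can be prolonged by an index \<open>j\<close> outside it if the last matching \<open>F\<close> has an edge from
  \<open>a j\<close> to a new label and an edge to \<open>b j\<close> from a vertex that is free or on the chain. With \<open>P\<close> and
  \<open>G\<close> the sets of edges of these two kinds, each \<open>j\<close> outside the chain is therefore met by at most
  one edge of \<open>P \<union> G\<close>, if no prolongation exists. Covering \<open>F\<close> once according to first ends and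
  once according to second ends, and using that the other classes of edges are excluded, bounds
  \<open>2 * card F\<close> by \<open>3 * card N\<close> plus the number of reused labels.\<close>

lemma ex_extension:
  assumes ch: "chain m s y z"
    and large: "\<And>i. i \<in> insert c N \<Longrightarrow> 5 * card N + 2 \<le> 3 * card (M i)"
    and size: "card (M (s m)) = card (M c)"
  shows "\<exists>j y' z'. chain (Suc m) (s(Suc m := j)) (y(m := y')) (z(m := z'))"
proof (rule ccontr)
  assume none: "\<not> ?thesis"
  define F where "F = M (s m)"
  define I where "I = s ` {1..m}"
  define N' where "N' = N - I"
  have IN: "I \<subseteq> N" using ch by (simp add: chain_def I_def)
  have finI: "finite I" and fin': "finite N'" using finite_N by (auto simp: I_def N'_def)
  have card_I: "card I = m" and mN: "m \<le> card N"
    using card_chain_indices[OF ch] by (auto simp: I_def)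
  have card_N': "card N' = card N - m"
    using IN finI card_I by (simp add: N'_def card_Diff_subset)
  have sm: "s m \<in> insert c N" using chain_color[OF ch] by simp
  have finF: "finite F" using large[OF sm] by (auto simp: F_def intro: card_ge_0_finite)
  have finc: "finite (M c)" using large[of c] by (auto intro: card_ge_0_finite)
  have inj1: "inj_on fst F" and inj2: "inj_on snd F"
    using inj_fst[OF sm] inj_snd[OF sm] by (auto simp: F_def)
  have le1: "card {e \<in> F. fst e \<in> a ` T} \<le> card T" if "finite T" for T
    using card_preimage_le[OF inj1, of "a ` T"] card_image_le[OF that, of a] that by simp
  have le2: "card {e \<in> F. snd e \<in> b ` T} \<le> card T" if "finite T" for T
    using card_preimage_le[OF inj2, of "b ` T"] card_image_le[OF that, of b] that by simp
  define P where "P = {e \<in> F. fst e \<in> a ` N' \<and> snd e \<notin> y ` {..<m} \<and> snd e \<notin> b ` N}"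
  define G where "G = {e \<in> F. fst e \<notin> a ` N' \<and> snd e \<in> b ` N'}"
  define R where "R = {e \<in> F. fst e \<notin> a ` N \<and> snd e \<in> y ` {..<m}}"
  have free: "snd e \<in> y ` {..<m} \<or> snd e \<in> b ` N'" if "e \<in> F" "fst e \<notin> a ` N" for e
    using free_edge_of_last[OF ch, of "fst e" "snd e"] that by (simp add: F_def N'_def I_def)
  have released: "snd e \<in> y ` {..<m} \<or> snd e \<in> b ` N" if "e \<in> F" "fst e \<in> a ` I" for e
  proof -
    obtain k where "1 \<le> k" "k \<le> m" "fst e = a (s k)" using \<open>fst e \<in> a ` I\<close> by (auto simp: I_def)
    then show ?thesis
      using released_edge_of_last[OF ch, of "k - 1" "snd e"] \<open>e \<in> F\<close>
      by (cases e) (auto simp: F_def)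
  qed
  have aN: "a ` N = a ` I \<union> a ` N'" and bN: "b ` N = b ` I \<union> b ` N'"
    using IN by (auto simp: N'_def)
  \<comment> \<open>An edge of \<open>F\<close> with neither end on a chosen edge outside the chain starts at a vertex of the
    chain, or it is in \<open>R\<close>.\<close>
  have "F \<subseteq> R \<union> G \<union> {e \<in> F. fst e \<in> a ` N'} \<union> {e \<in> F. fst e \<in> a ` I}"
    using free unfolding R_def G_def aN by blast
  then have "card F \<le> card (R \<union> G \<union> {e \<in> F. fst e \<in> a ` N'} \<union> {e \<in> F. fst e \<in> a ` I})"
    using finF by (intro card_mono) (auto simp: R_def G_def)
  also have "\<dots> \<le> card R + card G + card {e \<in> F. fst e \<in> a ` N'} + card {e \<in> F. fst e \<in> a ` I}"
    by (meson card_Un_le order_trans add_right_mono)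
  finally have c1: "card F \<le> card R + card G + card N' + m"
    using le1[OF finI] le1[OF fin'] card_I by linarith
  \<comment> \<open>An edge of \<open>F\<close> that ends at a free vertex other than a label must be in \<open>P\<close>.\<close>
  let ?Y = "{e \<in> F. snd e \<in> y ` {..<m}}"
  have "F \<subseteq> P \<union> ?Y \<union> {e \<in> F. snd e \<in> b ` N'} \<union> {e \<in> F. snd e \<in> b ` I}"
    using free released unfolding P_def aN bN by blast
  then have "card F \<le> card (P \<union> ?Y \<union> {e \<in> F. snd e \<in> b ` N'} \<union> {e \<in> F. snd e \<in> b ` I})"
    using finF by (intro card_mono) (auto simp: P_def)
  also have "\<dots> \<le> card P + card ?Y + card {e \<in> F. snd e \<in> b ` N'} + card {e \<in> F. snd e \<in> b ` I}"
    by (meson card_Un_le order_trans add_right_mono)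
  finally have c2: "card F \<le> card P + m + card N' + m"
    using le2[OF finI] le2[OF fin'] card_I card_preimage_le[OF inj2, of "y ` {..<m}"]
      card_image_le[of "{..<m}" y] by simp
  define JP where "JP = {j \<in> N'. a j \<in> fst ` P}"
  define JG where "JG = {j \<in> N'. b j \<in> snd ` G}"
  have "card P = card (fst ` P)"
    by (rule card_image[symmetric], rule inj_on_subset[OF inj1]) (auto simp: P_def)
  also have "fst ` P = a ` JP"
  proof -
    have "fst ` P \<subseteq> a ` N'" by (auto simp: P_def)
    then show ?thesis unfolding JP_def by (rule image_of_hits)
  qed
  also have "card \<dots> \<le> card JP" using fin' by (intro card_image_le) (simp add: JP_def)
  finally have P: "card P \<le> card JP" .
  have "card G = card (snd ` G)"
    by (rule card_image[symmetric], rule inj_on_subset[OF inj2]) (auto simp: G_def)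
  also have "snd ` G = b ` JG"
  proof -
    have "snd ` G \<subseteq> b ` N'" by (auto simp: G_def)
    then show ?thesis unfolding JG_def by (rule image_of_hits)
  qed
  also have "card \<dots> \<le> card JG" using fin' by (intro card_image_le) (simp add: JG_def)
  finally have G: "card G \<le> card JG" .
  have "JP \<inter> JG = {}"
  proof (rule ccontr)
    assume "JP \<inter> JG \<noteq> {}"
    then obtain j y' z' where j: "j \<in> N'" "(a j, y') \<in> P" "(z', b j) \<in> G"
      by (auto simp: JP_def JG_def)
    have "chain (Suc m) (s(Suc m := j)) (y(m := y')) (z(m := z'))"
      using j by (intro chain_extend[OF ch]) (auto simp: P_def G_def F_def N'_def I_def)
    then show False using none by blast
  qed
  then have "card JP + card JG = card (JP \<union> JG)"
    using fin' by (intro card_Un_disjoint[symmetric]) (auto simp: JP_def JG_def)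
  also have "\<dots> \<le> card N'" using fin' by (intro card_mono) (auto simp: JP_def JG_def)
  finally have "2 * card F \<le> card R + 3 * card N"
    using c1 c2 P G card_N' mN by linarith
  moreover have "card R + card F \<le> 2 * card N + 1"
    using card_reused_labels[OF ch finc] size by (simp add: R_def F_def)
  ultimately show False using large[OF sm] by (simp add: F_def)
qed

lemma not_large:
  assumes size: "\<And>i. i \<in> insert c N \<Longrightarrow> card (M i) = f"
  shows "3 * f \<le> 5 * card N + 1"
proof (rule ccontr)
  assume *: "\<not> ?thesis"
  have "\<exists>s y z. chain m s y z" for m
  proof (induction m)
    case 0
    then show ?case using chain_0 by blast
  next
    case (Suc m)
    then obtain s y z where ch: "chain m s y z" by blast
    have "\<exists>j y' z'. chain (Suc m) (s(Suc m := j)) (y(m := y')) (z(m := z'))"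
      by (rule ex_extension[OF ch]) (use * size size[OF chain_color[OF ch order_refl]] in auto)
    then show ?case by blast
  qed
  then obtain s y z where "chain (Suc (card N)) s y z" by blast
  then show False using card_chain_indices(2) by fastforce
qed

end

section \<open>Full rainbow matchings\<close>

text \<open>With \<open>card N = q + 1\<close> the size condition reads \<open>5 * q + 2 \<le> 3 * f\<close>, the exact opposite of the
  bound \<open>not_large\<close> for an unextendable rainbow matching; it passes on to subsets of \<open>N\<close>.\<close>

theorem ex_rainbow_pairs:
  fixes M :: "'i \<Rightarrow> ('a \<times> 'b) set"
  assumes "finite N"
    and "\<And>i. i \<in> N \<Longrightarrow> inj_on fst (M i)" and "\<And>i. i \<in> N \<Longrightarrow> inj_on snd (M i)"
    and "\<And>i. i \<in> N \<Longrightarrow> card (M i) = f"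
    and "5 * card N \<le> 3 * f + 3"
  shows "\<exists>e. rainbow_pairs M N e"
  using assms
proof (induction N rule: finite_induct)
  case empty
  then show ?case by (simp add: rainbow_pairs_def)
next
  case (insert c N)
  then obtain r where r: "rainbow_pairs M N r" by auto
  show ?case
  proof (rule ccontr)
    assume no: "\<nexists>e. rainbow_pairs M (insert c N) e"
    interpret unextendable_rainbow M N c "fst \<circ> r" "snd \<circ> r"
      using insert r no by unfold_locales (auto simp: rainbow_pairs_def)
    have "3 * f \<le> 5 * card N + 1" using not_large insert.prems(3) by blast
    then show False using insert by simp
  qed
qed

theorem theorem2p1:
  fixes V :: "'a set" and E :: "'a set set"
    and n :: nat and F :: "nat \<Rightarrow> 'a set set"
  assumes "bipartite_graph V E"
    and "n > 0"
    and "\<And>i. i \<in> {1..n} \<Longrightarrow> matching_in E (F i)"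
    and "\<And>i. i \<in> {1..n} \<Longrightarrow> int (card (F i)) = \<lfloor>5 / 3 * real n\<rfloor>"
  shows "\<exists>e. full_rainbow_matching n F e"
proof -
  obtain A B where AB: "A \<inter> B = {}" "\<And>e. e \<in> E \<Longrightarrow> \<exists>a\<in>A. \<exists>b\<in>B. e = {a, b}"
    using assms(1) by (auto simp: bipartite_graph_def)
  define edge :: "'a \<times> 'a \<Rightarrow> 'a set" where "edge = (\<lambda>(a, b). {a, b})"
  define M where "M i = {p \<in> A \<times> B. edge p \<in> F i}" for i
  have inj_edge: "inj_on edge (A \<times> B)"
    using AB(1) by (auto simp: inj_on_def edge_def doubleton_eq_iff)
  have F_sub: "F i \<subseteq> E" and F_disj: "pairwise disjnt (F i)" if "i \<in> {1..n}" for i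
    using assms(3)[OF that] by (auto simp: matching_in_def)
  have meet: "p = q" if "i \<in> {1..n}" "p \<in> M i" "q \<in> M i" "fst p = fst q \<or> snd p = snd q" for i p q
  proof -
    have "\<not> disjnt (edge p) (edge q)" using that(4) by (cases p; cases q) (auto simp: edge_def disjnt_def)
    then have "edge p = edge q" using F_disj[OF that(1)] that(2,3) by (auto simp: pairwise_def M_def)
    then show ?thesis using inj_edge that(2,3) by (auto simp: M_def dest: inj_onD)
  qed
  define f where "f = nat \<lfloor>5 / 3 * real n\<rfloor>"
  have card_M: "card (M i) = f" if i: "i \<in> {1..n}" for i
  proof -
    have "edge ` M i = F i"
      using AB(2) F_sub[OF i] by (fastforce simp: M_def edge_def)
    moreover have "inj_on edge (M i)" using inj_edge by (rule inj_on_subset) (auto simp: M_def)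
    ultimately have "card (M i) = card (F i)" by (metis card_image)
    then show ?thesis using assms(4)[OF i] by (simp add: f_def)
  qed
  \<comment> \<open>Rounding down loses at most \<open>2 / 3\<close>, so even \<open>5 * n \<le> 3 * f + 2\<close> holds.\<close>
  have "5 * n \<le> 3 * f + 3"
    unfolding f_def by linarith
  then have "\<exists>e. rainbow_pairs M {1..n} e"
    using meet card_M by (intro ex_rainbow_pairs[where f = f]) (auto simp: inj_on_def)
  then obtain e where e: "\<And>i. i \<in> {1..n} \<Longrightarrow> e i \<in> M i"
    "inj_on (fst \<circ> e) {1..n}" "inj_on (snd \<circ> e) {1..n}"
    unfolding rainbow_pairs_def by blast
  have "disjnt (edge (e i)) (edge (e j))" if ij: "i \<in> {1..n}" "j \<in> {1..n}" "i \<noteq> j" for i j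
  proof -
    have "fst (e i) \<noteq> fst (e j)" "snd (e i) \<noteq> snd (e j)"
      using inj_onD[OF e(2) _ ij(1,2)] inj_onD[OF e(3) _ ij(1,2)] ij(3) by auto
    moreover have "e i \<in> A \<times> B" "e j \<in> A \<times> B" using e(1) ij by (auto simp: M_def)
    ultimately show ?thesis
      using AB(1) by (cases "e i"; cases "e j") (auto simp: edge_def disjnt_def)
  qed
  then have "full_rainbow_matching n F (\<lambda>i. edge (e i))"
    using e(1) by (auto simp: full_rainbow_matching_def rainbow_matching_def M_def)
  then show ?thesis by blast
qed

end
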